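(* Let $X$ be a Banach space and let $T\in C(X)$ have a weakly hyperbolic point $x^\ast$. Then there exist a decomposition $X=X_u\oplus X_s$, an $\epsilon_0>0$, neighborhoods $U$ of $x^\ast$ in $X$ and $V_u,V_s$ of $0$ in $X_u,X_s$, respectively, and sets $W^{\rm u}_{loc}(x^\ast)$, $W^{\rm s}_{loc}(x^\ast)$ such that: (a) $W^{\rm u}_{loc}(x^\ast)$ is a graph of a Lipschitz map over $x^\ast+V_u$, and $W^{\rm s}_{loc}(x^\ast)$ is a graph of a Lipschitz map over $x^\ast+V_s$. (b) $T(W^{\rm u}_{loc}(x^\ast))\supset W^{\rm u}_{loc}(x^\ast)$, $T(W^{\rm s}_{loc}(x^\ast))\subset W^{\rm s}_{loc}(x^\ast)\cap T(X)$, and the restriction $T|_{W^{\rm u}_{loc}(x^\ast)}\colon W^{\rm u}_{loc}(x^\ast)\to T(W^{\rm u}_{loc}(x^\ast))$ is a homeomorphism. (c) $W^{\rm s}_{loc}(x^\ast)\cap W^{\rm u}_{loc}(x^\ast)=\{x^\ast\}$. (d) ${\rm Lip}\left(T|_{W^{\rm s}_{loc}(x^\ast)}\right)<1$ and ${\rm Lip}\left(T|_{W^{\rm u}_{loc}(x^\ast)}^{-1}\right)<1$. (e) One has 1. $W^{\rm s}_{loc}(x^\ast)=\{x\in U\colon T^n(x)\in U \text{ for all } n\geqslant 0 \text{ and } \|T^nx-x^\ast\|=o((1-\epsilon_0)^n) \text{ as } n\to\infty\}$; 2. $W^{\rm u}_{loc}(x^\ast)=\{x\in U\colon \text{there exists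 } \{x_j\}_{j\leqslant 0}\subset U \text{ with } x_0=x,\ x_{j+1}=T(x_j) \text{ and } \sup_{j\leqslant 0}(1+\epsilon_0)^{-j}\|x_j-x^\ast\|<\infty\}$.
   Context: $C(X)$ is the set of continuous maps $X\to X$. A point $x^\ast$ is an equilibrium point of $T$ if $T(x^\ast)=x^\ast$. ${\rm Lip}(\cdot)$ denotes a Lipschitz constant. Let $L$ be a bounded linear operator on $X$ with $\sigma(L)\cap\{\lambda\in\mathbb C:|\lambda|=1\}=\varnothing$. Put $\pi_s=\frac1{2\pi i}\int_{|\lambda|=1}(\lambda-L)^{-1}d\lambda$, $\pi_u=I-\pi_s$, $X_j=\pi_jX$, $L_j=L|_{X_j}$ ($j=u,s$). One has $0<b<1<a$ with $\sigma(L_s)\subset\{|\lambda|<b\}$ and $\sigma(L_u)\subset\{|\lambda|>a\}$, and $X$ is equipped with an equivalent norm satisfying $\|L_s\|\leqslant b$, $\|L_u^{-1}\|\leqslant a^{-1}$ and $\|x_u+x_s\|=\max\{\|x_u\|,\|x_s\|\}$. An equilibrium point $x^\ast$ of $T$ is a weakly hyperbolic point if the map $S(x)=T(x+x^\ast)-x^\ast$ has a decomposition $S=L+N$ such that: (i) $L$ is a bounded linear operator on $X$ with $\sigma(L)$ disjoint from the unit circle, and $0<b<1<a$ and the norm are as just described; (ii) there are a neighborhood $U_0$ of $0$ and $\gamma>0$ with $b+2\gamma<1<a-2\gamma$ and $\|N(x)-N(y)\|\leqslant\gamma\|x-y\|$ for all $x,y\in U_0$; (iii) $0<\gamma\,\|(I-L)^{-1}\|\leqslant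 1$. *)

theory Defs
  imports "HOL-Analysis.Analysis" "HOL-Library.Landau_Symbols"
begin

section \<open>Equivalent norms, operator norms, Lipschitz maps\<close>

definition equivalent_norm :: "('a::real_normed_vector \<Rightarrow> real) \<Rightarrow> bool" where
  "equivalent_norm nrm \<longleftrightarrow>
     (\<forall>x. nrm x = 0 \<longleftrightarrow> x = 0) \<and>
     (\<forall>c x. nrm (c *\<^sub>R x) = \<bar>c\<bar> * nrm x) \<and>
     (\<forall>x y. nrm (x + y) \<le> nrm x + nrm y) \<and>
     (\<exists>m>0. \<exists>M>0. \<forall>x. m * norm x \<le> nrm x \<and> nrm x \<le> M * norm x)"

text \<open>The analogue of \<^const>\<open>onorm\<close> for an operator on a subspace \<open>V\<close> normed by \<open>nrm\<close>.\<close>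

definition op_norm_on :: "('a::real_normed_vector \<Rightarrow> real) \<Rightarrow> 'a set \<Rightarrow> ('a \<Rightarrow> 'a) \<Rightarrow> real" where
  "op_norm_on nrm V A = (SUP x\<in>V. nrm (A x) / nrm x)"

definition lipschitz_wrt ::
    "('a::real_normed_vector \<Rightarrow> real) \<Rightarrow> real \<Rightarrow> 'a set \<Rightarrow> ('a \<Rightarrow> 'a) \<Rightarrow> bool" where
  "lipschitz_wrt nrm C A f \<longleftrightarrow>
     0 \<le> C \<and> (\<forall>x\<in>A. \<forall>y\<in>A. nrm (f x - f y) \<le> C * nrm (x - y))"

section \<open>Spectrum and spectral projection of an operator on a real Banach space\<close>

text \<open>
  As usual, the spectrum of an operator on a real space is that of its complexification. The
  complexification of \<open>'a\<close> is \<open>'a \<times> 'a\<close>, where \<open>(x, y)\<close> stands for \<open>x + i y\<close>. The product norm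
  need not be homogeneous for complex scalars, but it is equivalent to a norm that is; only its
  topology is used below. A complex Banach space is covered by viewing it as a real one: the
  complexification of a complex linear \<open>L\<close> is the direct sum of \<open>L\<close> and its conjugate, so that
  the spectrum is symmetrised under conjugation (which changes none of the conditions imposed
  below on moduli) and the spectral projection, restricted to \<open>'a\<close>, is unchanged.
\<close>

definition cscale :: "complex \<Rightarrow> ('a \<times> 'a) \<Rightarrow>\<^sub>L ('a::real_normed_vector \<times> 'a)" where
  "cscale c = Blinfun (\<lambda>z. (Re c *\<^sub>R fst z - Im c *\<^sub>R snd z, Im c *\<^sub>R fst z + Re c *\<^sub>R snd z))"

definition complexification ::
    "('a \<Rightarrow>\<^sub>L 'a) \<Rightarrow> ('a \<times> 'a) \<Rightarrow>\<^sub>L ('a::real_normed_vector \<times> 'a)" where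
  "complexification L = Blinfun (\<lambda>z. (L (fst z), L (snd z)))"

lemma cscale_apply:
  "cscale c z = (Re c *\<^sub>R fst z - Im c *\<^sub>R snd z, Im c *\<^sub>R fst z + Re c *\<^sub>R snd z)"
  unfolding cscale_def
  by (subst bounded_linear_Blinfun_apply) (auto intro!: bounded_linear_intros)

lemma complexification_apply: "complexification L z = (L (fst z), L (snd z))"
  unfolding complexification_def
  by (subst bounded_linear_Blinfun_apply) (auto intro!: bounded_linear_intros)

definition bounded_bijection_on :: "'b::real_normed_vector set \<Rightarrow> ('b \<Rightarrow> 'b) \<Rightarrow> bool" where
  "bounded_bijection_on V A \<longleftrightarrow>
     bij_betw A V V \<and> (\<exists>K. \<forall>w\<in>V. norm (inv_into V A w) \<le> K * norm w)"

text \<open>The spectrum of the restriction of \<open>L\<close> to an invariant subspace \<open>V\<close>, and of \<open>L\<close> itself.\<close>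

definition spectrum_on :: "'a::real_normed_vector set \<Rightarrow> ('a \<Rightarrow>\<^sub>L 'a) \<Rightarrow> complex set" where
  "spectrum_on V L =
     {\<mu>. \<not> bounded_bijection_on (V \<times> V) (blinfun_apply (cscale \<mu> - complexification L))}"

abbreviation spectrum :: "('a::real_normed_vector \<Rightarrow>\<^sub>L 'a) \<Rightarrow> complex set" where
  "spectrum L \<equiv> spectrum_on UNIV L"

definition resolvent ::
    "('a \<Rightarrow>\<^sub>L 'a) \<Rightarrow> complex \<Rightarrow> ('a \<times> 'a) \<Rightarrow>\<^sub>L ('a::real_normed_vector \<times> 'a)" where
  "resolvent L \<mu> = Blinfun (inv (blinfun_apply (cscale \<mu> - complexification L)))"

lemma resolvent_apply:
  fixes L :: "'a::real_normed_vector \<Rightarrow>\<^sub>L 'a"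
  assumes "\<mu> \<notin> spectrum L"
  shows "resolvent L \<mu> z = inv (blinfun_apply (cscale \<mu> - complexification L)) z"
proof -
  let ?A = "cscale \<mu> - complexification L"
  have bij: "bij (blinfun_apply ?A)"
    and bd: "\<exists>K. \<forall>w. norm (inv (blinfun_apply ?A) w) \<le> K * norm w"
    using assms by (auto simp: spectrum_on_def bounded_bijection_on_def)
  have inj: "inj (blinfun_apply ?A)" and surj: "surj (blinfun_apply ?A)"
    using bij by (auto simp: bij_def)
  have "linear (inv (blinfun_apply ?A))"
    by (rule linearI; rule inv_f_eq[OF inj])
       (simp_all add: blinfun.add_right blinfun.scaleR_right surj_f_inv_f[OF surj])
  then have "bounded_linear (inv (blinfun_apply ?A))"
    using bd by (auto simp: bounded_linear_def bounded_linear_axioms_def mult.commute)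
  then show ?thesis
    unfolding resolvent_def by (simp add: bounded_linear_Blinfun_apply)
qed

text \<open>
  \<open>1 / (2 \<pi> i)\<close> times the integral of the resolvent along \<open>\<mu> = exp (i t)\<close>, \<open>d\<mu> = i exp (i t) dt\<close>.
\<close>

definition riesz_integral ::
    "('a \<Rightarrow>\<^sub>L 'a) \<Rightarrow> ('a \<times> 'a) \<Rightarrow>\<^sub>L ('a::banach \<times> 'a)" where
  "riesz_integral L =
     cscale (1 / (2 * complex_of_real pi * \<i>)) o\<^sub>L
     integral {0..2 * pi} (\<lambda>t. cscale (\<i> * cis t) o\<^sub>L resolvent L (cis t))"

text \<open>
  The contour is symmetric under conjugation, so the integral commutes with conjugation and maps
  the real part \<open>'a \<times> {0}\<close> of the complexification to itself.
\<close>

definition proj_s :: "('a::banach \<Rightarrow>\<^sub>L 'a) \<Rightarrow> 'a \<Rightarrow> 'a" where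
  "proj_s L x = fst (riesz_integral L (x, 0))"

definition proj_u :: "('a::banach \<Rightarrow>\<^sub>L 'a) \<Rightarrow> 'a \<Rightarrow> 'a" where
  "proj_u L x = x - proj_s L x"

definition space_s :: "('a::banach \<Rightarrow>\<^sub>L 'a) \<Rightarrow> 'a set" where
  "space_s L = range (proj_s L)"

definition space_u :: "('a::banach \<Rightarrow>\<^sub>L 'a) \<Rightarrow> 'a set" where
  "space_u L = range (proj_u L)"

section \<open>Weakly hyperbolic points\<close>

definition adapted_norm ::
    "('a::banach \<Rightarrow> real) \<Rightarrow> ('a \<Rightarrow>\<^sub>L 'a) \<Rightarrow> real \<Rightarrow> real \<Rightarrow> bool" where
  "adapted_norm nrm L a b \<longleftrightarrow>
     equivalent_norm nrm \<and>
     0 < b \<and> b < 1 \<and> 1 < a \<and>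
     spectrum_on (space_s L) L \<subseteq> {\<mu>. cmod \<mu> < b} \<and>
     spectrum_on (space_u L) L \<subseteq> {\<mu>. cmod \<mu> > a} \<and>
     op_norm_on nrm (space_s L) L \<le> b \<and>
     op_norm_on nrm (space_u L) (inv_into (space_u L) L) \<le> inverse a \<and>
     (\<forall>xu\<in>space_u L. \<forall>xs\<in>space_s L. nrm (xu + xs) = max (nrm xu) (nrm xs))"

text \<open>\<open>V\<close> is a (not necessarily open) neighbourhood of \<open>p\<close> in the subspace topology of \<open>S\<close>.\<close>

definition neighbourhood_in :: "'a::topological_space set \<Rightarrow> 'a \<Rightarrow> 'a set \<Rightarrow> bool" where
  "neighbourhood_in S p V \<longleftrightarrow>
     V \<subseteq> S \<and> (\<exists>G. openin (top_of_set S) G \<and> p \<in> G \<and> G \<subseteq> V)"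

text \<open>
  The space is \<open>'a\<close> equipped with the equivalent norm \<open>nrm\<close>; Lipschitz constants and operator
  norms refer to \<open>nrm\<close>.
\<close>

definition weakly_hyperbolic_point ::
    "('a::banach \<Rightarrow> real) \<Rightarrow> ('a \<Rightarrow> 'a) \<Rightarrow> 'a \<Rightarrow> bool" where
  "weakly_hyperbolic_point nrm T p \<longleftrightarrow>
     T p = p \<and>
     (\<exists>L N a b \<gamma> U0.
        (\<forall>x. T (x + p) - p = blinfun_apply L x + N x) \<and>
        spectrum L \<inter> {\<mu>. cmod \<mu> = 1} = {} \<and>
        adapted_norm nrm L a b \<and>
        neighbourhood_in UNIV 0 U0 \<and>
        0 < \<gamma> \<and> b + 2 * \<gamma> < 1 \<and> 1 < a - 2 * \<gamma> \<and>
        lipschitz_wrt nrm \<gamma> U0 N \<and>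
        0 < \<gamma> * op_norm_on nrm UNIV (inv (\<lambda>x. x - blinfun_apply L x)) \<and>
        \<gamma> * op_norm_on nrm UNIV (inv (\<lambda>x. x - blinfun_apply L x)) \<le> 1)"

section \<open>Decompositions and graphs\<close>

definition direct_sum_decomposition :: "'a::real_normed_vector set \<Rightarrow> 'a set \<Rightarrow> bool" where
  "direct_sum_decomposition Y Z \<longleftrightarrow>
     subspace Y \<and> closed Y \<and> subspace Z \<and> closed Z \<and>
     Y \<inter> Z = {0} \<and> (\<forall>x. \<exists>y\<in>Y. \<exists>z\<in>Z. x = y + z)"

text \<open>\<open>W\<close> is the graph over \<open>p + V\<close> of a Lipschitz map with values in the complement \<open>Z\<close>.\<close>

definition lipschitz_graph_over ::
    "('a::real_normed_vector \<Rightarrow> real) \<Rightarrow> 'a \<Rightarrow> 'a set \<Rightarrow> 'a set \<Rightarrow> 'a set \<Rightarrow> bool" where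
  "lipschitz_graph_over nrm p V Z W \<longleftrightarrow>
     (\<exists>h C. h ` V \<subseteq> Z \<and> lipschitz_wrt nrm C V h \<and> W = (\<lambda>v. p + v + h v) ` V)"

end

theory Submission
  imports Defs
begin

text \<open>
  Write \<open>T (p + x) = p + S x\<close> with \<open>S = L + N\<close>, and let \<open>r\<close> be so small that \<open>N\<close> is
  \<open>\<gamma>\<close>-Lipschitz on the ball \<open>nrm x \<le> r\<close>. The proof is the method of Lyapunov and Perron, applied to
  the orbits of \<open>S\<close> that stay in this ball.

  The equation \<open>x' = S x\<close> splits into a stable and an unstable component. The stable component is
  read forwards, \<open>x'\<^sub>s = L x\<^sub>s + N\<^sub>s x\<close>; the unstable one is solved for the earlier state,
  \<open>x\<^sub>u = L\<^sub>u\<^sup>-\<^sup>1 (x'\<^sub>u - N\<^sub>u x)\<close>. In this form both contract, with the constants \<open>b + \<gamma>\<close> and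
  \<open>(1 + \<gamma>) / a\<close>, the larger of which is called \<open>\<kappa>\<close>. As the norm is the maximum of the norms of the
  two components, the ball is a product of balls in \<open>X\<^sub>u\<close> and \<open>X\<^sub>s\<close>. So the whole system of
  equations, for all times at once, is a contraction of the set of sequences in the ball, once the
  stable component is prescribed at the start of a forward orbit, or the unstable component at the
  end of a backward orbit. Hence every choice of these data is realised by an orbit (\<open>ex_forward_orbit\<close>,
  \<open>ex_backward_orbit\<close>), and the ball is mapped to itself without any modification of \<open>N\<close> outside it.

  The same contraction shows that two such orbits are at no time further apart than their
  prescribed components (\<open>forward_orbit_diff\<close>, \<open>backward_orbit_diff\<close>). Three consequences follow.
  The set of starting points of forward orbits and the set of end points of backward orbits are
  graphs of \<open>1\<close>-Lipschitz maps over balls of radius \<open>r\<close> in \<open>X\<^sub>s\<close> and \<open>X\<^sub>u\<close>. On the first set, all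
  distances are distances of stable components, so \<open>S\<close> contracts by \<open>b + \<gamma>\<close>; on the second, they
  are distances of unstable components, so \<open>S\<close> expands by \<open>a - \<gamma>\<close>. And orbits in these sets decay
  geometrically at these rates. With \<open>\<epsilon>\<^sub>0 = \<gamma>\<close>, the inequalities \<open>b + 2 \<gamma> < 1 < a - 2 \<gamma>\<close> say that
  this is faster than \<open>1 - \<epsilon>\<^sub>0\<close> and \<open>1 + \<epsilon>\<^sub>0\<close> require, so the growth conditions in the
  characterisation of the local manifolds hold for every orbit that stays in the ball.

  The algebra of the splitting is read off from the spectral data (\<open>adapted_norm_splitting\<close>). The
  maximum formula for the norm forces \<open>X\<^sub>u \<inter> X\<^sub>s = 0\<close>, and since \<open>\<pi>\<^sub>u = I - \<pi>\<^sub>s\<close> this already makes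
  \<open>\<pi>\<^sub>s\<close> a projection. That \<open>1\<close> lies outside the spectrum of \<open>L\<^sub>s\<close> and \<open>0\<close> outside that of \<open>L\<^sub>u\<close> says
  that \<open>I - L\<close> maps \<open>X\<^sub>s\<close> onto itself and \<open>L\<close> maps \<open>X\<^sub>u\<close> bijectively onto itself, so both
  subspaces are invariant.
\<close>

section \<open>Equivalent norms\<close>

context
  fixes nrm :: "'a::real_normed_vector \<Rightarrow> real"
  assumes nrm: "equivalent_norm nrm"
begin

lemma nrm_nonneg: "0 \<le> nrm x"
proof -
  obtain m where "m > 0" "m * norm x \<le> nrm x"
    using nrm by (auto simp: equivalent_norm_def)
  then show ?thesis
    by (smt (verit) mult_nonneg_nonneg norm_ge_zero)
qed

lemma nrm_eq_0: "nrm x = 0 \<longleftrightarrow> x = 0"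
  using nrm by (simp add: equivalent_norm_def)

lemma nrm_minus: "nrm (- x) = nrm x"
proof -
  have "nrm ((-1) *\<^sub>R x) = \<bar>-1\<bar> * nrm x"
    using nrm unfolding equivalent_norm_def by blast
  then show ?thesis by simp
qed

lemma nrm_minus_commute: "nrm (x - y) = nrm (y - x)"
  using nrm_minus[of "x - y"] by simp

lemma nrm_triangle: "nrm (x + y) \<le> nrm x + nrm y"
  using nrm by (simp add: equivalent_norm_def)

lemma nrm_triangle_diff: "nrm (x - y) \<le> nrm x + nrm y"
  using nrm_triangle[of x "- y"] by (simp add: nrm_minus)

lemma nrm_lower: obtains m where "m > 0" "\<And>x. m * norm x \<le> nrm x"
  using nrm by (auto simp: equivalent_norm_def)

lemma nrm_upper: obtains M where "M > 0" "\<And>x. nrm x \<le> M * norm x"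
  using nrm by (auto simp: equivalent_norm_def)

lemma tendsto_nrm:
  assumes "(f \<longlongrightarrow> l) F"
  shows "((\<lambda>x. nrm (f x)) \<longlongrightarrow> nrm l) F"
proof -
  obtain M where M: "M > 0" "\<And>x. nrm x \<le> M * norm x" using nrm_upper by blast
  have bound: "norm (nrm (f x) - nrm l) \<le> M * norm (f x - l)" for x
    using nrm_triangle[of "f x - l" l] nrm_triangle[of "l - f x" "f x"]
      M(2)[of "f x - l"] nrm_minus_commute[of l "f x"] by auto
  have "((\<lambda>x. M * norm (f x - l)) \<longlongrightarrow> M * 0) F"
    using assms by (intro tendsto_intros tendsto_norm_zero) (simp add: LIM_zero)
  then have "((\<lambda>x. nrm (f x) - nrm l) \<longlongrightarrow> 0) F"
    by (simp add: Lim_null_comparison[OF always_eventually[OF allI[OF bound]]])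
  then show ?thesis by (rule LIM_zero_cancel)
qed

lemma continuous_on_nrm: "continuous_on A nrm"
  unfolding continuous_on_def by (intro ballI tendsto_nrm tendsto_ident_at)

lemma lipschitz_wrt_imp_continuous_on:
  assumes "lipschitz_wrt nrm C A f"
  shows "continuous_on A f"
proof (rule continuous_onI)
  fix x e :: real and z assume z: "z \<in> A" and e: "0 < e"
  obtain m where m: "m > 0" "\<And>x. m * norm x \<le> nrm x" using nrm_lower by blast
  obtain M where M: "M > 0" "\<And>x. nrm x \<le> M * norm x" using nrm_upper by blast
  have C: "0 \<le> C" using assms by (simp add: lipschitz_wrt_def)
  show "\<exists>d>0. \<forall>x'\<in>A. dist x' z < d \<longrightarrow> dist (f x') (f z) \<le> e"
  proof (intro exI conjI ballI impI)
    \<comment> \<open>The summand \<open>1\<close> keeps the denominator positive if \<open>C = 0\<close>.\<close>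
    show "0 < m * e / (C * M + 1)"
      using m(1) M(1) C e by (intro divide_pos_pos mult_pos_pos) (auto intro: add_nonneg_pos)
    fix x' assume x': "x' \<in> A" and d: "dist x' z < m * e / (C * M + 1)"
    have pos: "0 < C * M + 1" using C M(1) by (auto intro: add_nonneg_pos)
    have "m * norm (f x' - f z) \<le> C * nrm (x' - z)"
      using m(2)[of "f x' - f z"] assms x' z by (auto simp: lipschitz_wrt_def intro: order_trans)
    also have "\<dots> \<le> C * (M * norm (x' - z))"
      using C M(2) by (intro mult_left_mono) auto
    also have "\<dots> \<le> (C * M + 1) * norm (x' - z)" by (simp add: algebra_simps)
    also have "\<dots> \<le> m * e"
      using d pos by (simp add: dist_norm pos_less_divide_eq mult.commute)
    finally show "dist (f x') (f z) \<le> e" using m(1) by (simp add: dist_norm)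
  qed
qed

lemma neighbourhood_in_nrm_ball:
  assumes "p \<in> X" "0 < r"
  shows "neighbourhood_in X p {x \<in> X. nrm (x - p) \<le> r}"
proof -
  have "open {x. nrm (x - p) < r}"
    by (intro open_Collect_less continuous_on_const continuous_on_compose2[OF continuous_on_nrm[of UNIV]]
        continuous_intros) auto
  then have "openin (top_of_set X) (X \<inter> {x. nrm (x - p) < r})"
    by (rule openin_open_Int)
  then show ?thesis
    using assms nrm_eq_0[of 0] unfolding neighbourhood_in_def
    by (intro conjI exI[of _ "X \<inter> {x. nrm (x - p) < r}"]) auto
qed

lemma neighbourhood_in_UNIV_contains_ball:
  assumes "neighbourhood_in UNIV 0 U"
  obtains r where "0 < r" "\<And>x. nrm x \<le> r \<Longrightarrow> x \<in> U"
proof -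
  obtain G where G: "open G" "0 \<in> G" "G \<subseteq> U"
    using assms by (auto simp: neighbourhood_in_def)
  then obtain e where e: "0 < e" "ball 0 e \<subseteq> G" by (meson openE)
  obtain m where m: "m > 0" "\<And>x. m * norm x \<le> nrm x" using nrm_lower by blast
  show ?thesis
  proof (rule that[of "m * e / 2"])
    show "0 < m * e / 2" using m(1) e(1) by simp
    fix x assume "nrm x \<le> m * e / 2"
    then have "m * norm x \<le> m * (e / 2)" using m(2)[of x] by simp
    then have "norm x < e" using m(1) e(1) by simp
    then show "x \<in> U" using e(2) G(3) by auto
  qed
qed

lemma expansion_inverse:
  assumes c: "0 < c" and ex: "\<And>x y. x \<in> W \<Longrightarrow> y \<in> W \<Longrightarrow> c * nrm (x - y) \<le> nrm (f x - f y)"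
  shows "lipschitz_wrt nrm (inverse c) (f ` W) (inv_into W f)"
    and "continuous_on W f \<Longrightarrow> homeomorphism W (f ` W) f (inv_into W f)"
proof -
  have inj: "inj_on f W"
  proof (rule inj_onI)
    fix x y assume "x \<in> W" "y \<in> W" "f x = f y"
    then have "c * nrm (x - y) \<le> 0" using ex[of x y] nrm_eq_0[of 0] by simp
    then have "nrm (x - y) = 0"
      using c nrm_nonneg[of "x - y"] by (simp add: mult_le_0_iff)
    then show "x = y" by (simp add: nrm_eq_0)
  qed
  show lip: "lipschitz_wrt nrm (inverse c) (f ` W) (inv_into W f)"
    unfolding lipschitz_wrt_def using c ex inj
    by (auto simp: field_simps)
  show "homeomorphism W (f ` W) f (inv_into W f)" if "continuous_on W f"
    using that lipschitz_wrt_imp_continuous_on[OF lip] inj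
    by (auto simp: homeomorphism_def inv_into_f_f image_image)
qed

text \<open>
  The bound on \<open>A\<close> in the original norm guarantees that the supremum defining the operator norm
  is over a bounded set.
\<close>

lemma op_norm_on_bound:
  assumes x: "x \<in> V" and bdd: "\<And>y. y \<in> V \<Longrightarrow> norm (A y) \<le> K * norm y"
  shows "nrm (A x) \<le> op_norm_on nrm V A * nrm x"
proof -
  obtain m where m: "m > 0" "\<And>x. m * norm x \<le> nrm x" using nrm_lower by blast
  obtain M where M: "M > 0" "\<And>x. nrm x \<le> M * norm x" using nrm_upper by blast
  have ratio: "nrm (A y) / nrm y \<le> M * \<bar>K\<bar> / m" if "y \<in> V" for y
  proof (cases "y = 0")
    case True
    then show ?thesis using m(1) M(1) nrm_eq_0[of 0] by simp
  next
    case False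
    then have pos: "0 < nrm y" using nrm_nonneg[of y] nrm_eq_0[of y] by simp
    have "nrm (A y) \<le> M * norm (A y)" by (rule M(2))
    also have "\<dots> \<le> M * (\<bar>K\<bar> * norm y)"
      using M(1) order_trans[OF bdd[OF that] mult_right_mono[OF abs_ge_self norm_ge_zero]]
      by (intro mult_left_mono) auto
    also have "\<dots> \<le> M * (\<bar>K\<bar> * (nrm y / m))"
      using M(1) m by (intro mult_left_mono) (auto simp: field_simps)
    finally show ?thesis using pos by (simp add: field_simps)
  qed
  have bd: "bdd_above ((\<lambda>y. nrm (A y) / nrm y) ` V)"
    by (rule bdd_aboveI2[OF ratio])
  show ?thesis
  proof (cases "x = 0")
    case True
    have "norm (A x) \<le> 0" using bdd[OF x] True by simp
    then show ?thesis using True nrm_eq_0[of 0] by simp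
  next
    case False
    then have pos: "0 < nrm x" using nrm_nonneg[of x] nrm_eq_0[of x] by simp
    show ?thesis
      using cSUP_upper[OF x bd] pos by (simp add: op_norm_on_def field_simps)
  qed
qed

text \<open>
  If \<open>P\<close> does not shrink distances within \<open>E\<close>, then \<open>P\<close> is injective on \<open>E\<close>. So \<open>E\<close> is the graph of
  the map that sends \<open>P x\<close> to \<open>Q x\<close>, which is \<open>1\<close>-Lipschitz because \<open>Q\<close> does not increase norms.
\<close>

lemma lipschitz_graph_over_projection:
  assumes P: "linear P" and Q: "linear Q" and PQ: "\<And>x. P x + Q x = x"
    and Q_le: "\<And>x. nrm (Q x) \<le> nrm x"
    and cone: "\<And>x y. x \<in> E \<Longrightarrow> y \<in> E \<Longrightarrow> nrm (x - y) \<le> nrm (P (x - y))"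
  shows "lipschitz_graph_over nrm p (P ` E) (range Q) ((+) p ` E)"
proof -
  define e where "e = inv_into E P"
  have inj: "inj_on P E"
  proof (rule inj_onI)
    fix x y assume xy: "x \<in> E" "y \<in> E" "P x = P y"
    then have "nrm (x - y) \<le> 0"
      using cone[of x y] nrm_eq_0[of 0] by (simp add: linear_diff[OF P])
    then show "x = y" using nrm_nonneg[of "x - y"] nrm_eq_0[of "x - y"] by simp
  qed
  have e_P: "e (P x) = x" if "x \<in> E" for x
    using inj that by (simp add: e_def)
  have "lipschitz_wrt nrm 1 (P ` E) (\<lambda>v. Q (e v))"
    unfolding lipschitz_wrt_def
  proof safe
    fix x y assume "x \<in> E" "y \<in> E"
    then show "nrm (Q (e (P x)) - Q (e (P y))) \<le> 1 * nrm (P x - P y)"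
      using order_trans[OF Q_le cone[of x y]]
      by (simp add: e_P linear_diff[OF P] linear_diff[OF Q, symmetric])
  qed simp
  moreover have "(+) p ` E = (\<lambda>v. p + v + Q (e v)) ` P ` E"
    unfolding image_image by (rule image_cong) (simp_all add: e_P PQ add.assoc)
  ultimately show ?thesis
    unfolding lipschitz_graph_over_def by (intro exI[of _ "\<lambda>v. Q (e v)"] exI[of _ 1]) auto
qed

end

section \<open>Contractions on families of points\<close>

text \<open>
  The supremum \<open>D\<close> of the family satisfies \<open>D \<le> max c (k D)\<close> with \<open>k < 1\<close>, hence \<open>D \<le> c\<close>.
\<close>

lemma contraction_bound:
  fixes g :: "'i \<Rightarrow> real"
  assumes k: "k < 1" and c: "0 \<le> c" and bdd: "\<And>i. g i \<le> B" and nonneg: "\<And>i. 0 \<le> g i"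
    and step: "\<And>d i. (\<And>i. g i \<le> d) \<Longrightarrow> g i \<le> max c (k * d)"
  shows "g i \<le> c"
proof -
  let ?D = "SUP i. g i"
  have le: "g i \<le> ?D" for i
    using bdd by (intro cSUP_upper bdd_aboveI2) auto
  have "?D \<le> max c (k * ?D)"
    using step[OF le] by (intro cSUP_least) auto
  moreover have "?D \<le> c" if "?D \<le> k * ?D"
  proof -
    have "(1 - k) * ?D \<le> 0" using that by (simp add: algebra_simps)
    then show ?thesis using k c by (auto simp: mult_le_0_iff)
  qed
  ultimately show ?thesis using le[of i] by (auto simp: le_max_iff_disj)
qed

text \<open>
  Banach's fixed point theorem for the supremum distance on families of points of a ball. The
  Picard iterates converge entry by entry, by completeness of the underlying space, and the uniform
  estimate \<open>k\<^sup>n r\<close> for the distance from the limit carries the fixed point equation to the limit.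
\<close>

lemma family_contraction_fixed_point:
  fixes nrm :: "'a::banach \<Rightarrow> real" and \<Phi> :: "('i \<Rightarrow> 'a) \<Rightarrow> 'i \<Rightarrow> 'a"
  assumes nrm: "equivalent_norm nrm" and k: "0 \<le> k" "k < 1" and r: "0 \<le> r"
    and self: "\<And>x i. (\<And>j. nrm (x j) \<le> r) \<Longrightarrow> nrm (\<Phi> x i) \<le> r"
    and contr: "\<And>x y d i. (\<And>j. nrm (x j) \<le> r) \<Longrightarrow> (\<And>j. nrm (y j) \<le> r) \<Longrightarrow>
                  (\<And>j. nrm (x j - y j) \<le> d) \<Longrightarrow> nrm (\<Phi> x i - \<Phi> y i) \<le> k * d"
  obtains x where "\<And>i. nrm (x i) \<le> r" "\<Phi> x = x"
proof -
  define z where "z n = (\<Phi> ^^ n) (\<lambda>_. 0)" for n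
  have z_0: "z 0 = (\<lambda>_. 0)" and z_Suc: "z (Suc n) = \<Phi> (z n)" for n
    by (simp_all add: z_def)
  have ball: "nrm (z n i) \<le> r" for n i
  proof (induction n arbitrary: i)
    case 0
    show ?case using r nrm_eq_0[OF nrm, of 0] by (simp add: z_0)
  next
    case (Suc n)
    show ?case unfolding z_Suc by (rule self) (rule Suc)
  qed
  have close: "nrm (z (n + m) i - z n i) \<le> k ^ n * r" for n m i
  proof (induction n arbitrary: i)
    case 0
    show ?case using ball by (simp add: z_0)
  next
    case (Suc n)
    have "nrm (\<Phi> (z (n + m)) i - \<Phi> (z n) i) \<le> k * (k ^ n * r)"
      by (rule contr[OF ball ball Suc])
    then show ?case by (simp add: z_Suc mult.assoc)
  qed
  have lim0: "(\<lambda>n. k ^ n * r) \<longlonglongrightarrow> 0"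
    using LIMSEQ_power_zero[of k] k tendsto_mult_left_zero by fastforce
  obtain m where m: "m > 0" "\<And>x. m * norm x \<le> nrm x" using nrm_lower[OF nrm] by blast
  have "Cauchy (\<lambda>n. z n i)" for i
  proof (rule CauchyI')
    fix e :: real assume "0 < e"
    then have "0 < m * e" using m(1) by simp
    then obtain n0 where n0: "\<And>n. n \<ge> n0 \<Longrightarrow> k ^ n * r < m * e"
      using order_tendstoD(2)[OF lim0] by (auto simp: eventually_sequentially)
    have "dist (z n i) (z l i) < e" if "n \<ge> n0" "l > n" for n l
    proof -
      have "m * norm (z (n + (l - n)) i - z n i) \<le> k ^ n * r"
        using m(2) close order_trans by blast
      also have "\<dots> < m * e" using n0 that by simp
      finally show ?thesis using m(1) that by (simp add: dist_norm norm_minus_commute)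
    qed
    then show "\<exists>M. \<forall>n\<ge>M. \<forall>l>n. dist (z n i) (z l i) < e" by blast
  qed
  then have "\<exists>l. (\<lambda>n. z n i) \<longlonglongrightarrow> l" for i
    by (simp add: Cauchy_convergent_iff convergent_def)
  then obtain x where x: "\<And>i. (\<lambda>n. z n i) \<longlonglongrightarrow> x i" by metis
  have x_ball: "nrm (x i) \<le> r" for i
    using ball by (intro LIMSEQ_le_const2[OF tendsto_nrm[OF nrm x]]) auto
  have x_close: "nrm (x i - z n i) \<le> k ^ n * r" for i n
  proof (rule LIMSEQ_le_const2)
    show "(\<lambda>l. nrm (z (l + n) i - z n i)) \<longlonglongrightarrow> nrm (x i - z n i)"
      by (rule tendsto_nrm[OF nrm tendsto_diff[OF LIMSEQ_ignore_initial_segment[OF x] tendsto_const]])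
    show "\<exists>N. \<forall>l\<ge>N. nrm (z (l + n) i - z n i) \<le> k ^ n * r"
      using close[of n] by (auto simp: add.commute)
  qed
  have "\<Phi> x i = x i" for i
  proof -
    have bound: "nrm (\<Phi> x i - x i) \<le> 2 * (k ^ n * r)" for n
    proof -
      have "nrm (\<Phi> x i - z (Suc n) i) \<le> k * (k ^ n * r)"
        unfolding z_Suc by (rule contr[OF x_ball ball x_close])
      also have "\<dots> \<le> k ^ n * r"
        using k r by (intro mult_left_le_one_le) auto
      finally have "nrm (\<Phi> x i - z (Suc n) i) \<le> k ^ n * r" .
      moreover have "nrm (x i - z (Suc n) i) \<le> k ^ n * r"
      proof -
        have "k * (k ^ n * r) \<le> k ^ n * r"
          using k r by (intro mult_left_le_one_le) auto
        then show ?thesis using x_close[of i "Suc n"] by (simp add: mult.assoc)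
      qed
      moreover have "nrm ((\<Phi> x i - z (Suc n) i) - (x i - z (Suc n) i))
                     \<le> nrm (\<Phi> x i - z (Suc n) i) + nrm (x i - z (Suc n) i)"
        by (rule nrm_triangle_diff[OF nrm])
      ultimately show ?thesis by simp
    qed
    have "(\<lambda>n. 2 * (k ^ n * r)) \<longlonglongrightarrow> 2 * 0"
      by (intro tendsto_intros lim0)
    then have "nrm (\<Phi> x i - x i) \<le> 2 * 0"
      by (rule LIMSEQ_le_const) (use bound in blast)
    then show ?thesis
      using nrm_nonneg[OF nrm, of "\<Phi> x i - x i"] nrm_eq_0[OF nrm, of "\<Phi> x i - x i"] by simp
  qed
  then have "\<Phi> x = x" by blast
  with x_ball show ?thesis by (rule that)
qed

section \<open>Lipschitz perturbations of a hyperbolic splitting\<close>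

text \<open>
  The inequalities \<open>b + \<gamma> < 1\<close> and \<open>1 + \<gamma> < a\<close> say that a perturbation of size \<open>\<gamma>\<close> leaves the
  stable component contracting and the unstable one expanding.
\<close>

locale perturbed_splitting =
  fixes nrm :: "'a::banach \<Rightarrow> real" and Ps Pu L N :: "'a \<Rightarrow> 'a" and a b \<gamma> r :: real
  assumes nrm: "equivalent_norm nrm"
    and linear_Ps: "linear Ps" and Pu_eq: "Pu x = x - Ps x" and Ps_Ps: "Ps (Ps x) = Ps x"
    and nrm_max: "nrm x = max (nrm (Ps x)) (nrm (Pu x))"
    and linear_L: "linear L" and Ps_L: "Ps (L x) = L (Ps x)"
    and L_stable: "nrm (L (Ps x)) \<le> b * nrm (Ps x)"
    and L_unstable: "a * nrm (Pu x) \<le> nrm (L (Pu x))"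
    and L_surj: "\<exists>y. L (Pu y) = Pu x"
    and N_0: "N 0 = 0"
    and N_lipschitz: "nrm x \<le> r \<Longrightarrow> nrm y \<le> r \<Longrightarrow> nrm (N x - N y) \<le> \<gamma> * nrm (x - y)"
    and r: "0 < r" and \<gamma>: "0 < \<gamma>" and b: "0 < b" "b + \<gamma> < 1" and a: "1 + \<gamma> < a"
begin

abbreviation S :: "'a \<Rightarrow> 'a" where
  "S x \<equiv> L x + N x"

lemmas nonneg = nrm_nonneg[OF nrm]
lemmas eq_0 = nrm_eq_0[OF nrm]

lemma nrm_0 [simp]: "nrm 0 = 0"
  by (simp add: eq_0)

lemma linear_Pu: "linear Pu"
proof -
  have "Pu = (\<lambda>x. x - Ps x)" by (simp add: Pu_eq fun_eq_iff)
  then show ?thesis using linear_Ps by (simp add: linear_compose_sub linear_id[unfolded id_def])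
qed

lemmas lin_simps =
  linear_add[OF linear_Ps] linear_diff[OF linear_Ps] linear_0[OF linear_Ps]
  linear_add[OF linear_Pu] linear_diff[OF linear_Pu] linear_0[OF linear_Pu]
  linear_add[OF linear_L] linear_diff[OF linear_L] linear_0[OF linear_L]

lemma Pu_Pu: "Pu (Pu x) = Pu x" and Ps_Pu: "Ps (Pu x) = 0" and Pu_Ps: "Pu (Ps x) = 0"
  by (simp_all add: Pu_eq lin_simps Ps_Ps)

lemma Pu_L: "Pu (L x) = L (Pu x)"
  by (simp add: Pu_eq lin_simps Ps_L)

lemma Ps_plus_Pu: "Ps x + Pu x = x"
  by (simp add: Pu_eq)

lemma nrm_Ps_le: "nrm (Ps x) \<le> nrm x" and nrm_Pu_le: "nrm (Pu x) \<le> nrm x"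
  using nrm_max[of x] by auto

lemma S_0: "S 0 = 0"
  by (simp add: lin_simps N_0)

lemma stable_contracts:
  assumes "nrm x \<le> r" "nrm y \<le> r"
  shows "nrm (Ps (S x - S y)) \<le> (b + \<gamma>) * nrm (x - y)"
proof -
  have "Ps (S x - S y) = L (Ps (x - y)) + Ps (N x - N y)"
    by (simp add: lin_simps Ps_L)
  also have "nrm \<dots> \<le> nrm (L (Ps (x - y))) + nrm (Ps (N x - N y))"
    by (rule nrm_triangle[OF nrm])
  also have "\<dots> \<le> b * nrm (Ps (x - y)) + nrm (N x - N y)"
    by (intro add_mono L_stable nrm_Ps_le)
  also have "\<dots> \<le> b * nrm (x - y) + \<gamma> * nrm (x - y)"
    using b by (intro add_mono mult_left_mono nrm_Ps_le N_lipschitz assms) auto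
  finally show ?thesis by (simp add: algebra_simps)
qed

lemma unstable_expands:
  assumes "nrm x \<le> r" "nrm y \<le> r"
  shows "a * nrm (Pu (x - y)) \<le> nrm (Pu (S x - S y)) + \<gamma> * nrm (x - y)"
proof -
  have "L (Pu (x - y)) = Pu (S x - S y) - Pu (N x - N y)"
    by (simp add: lin_simps Pu_L)
  then have "nrm (L (Pu (x - y))) \<le> nrm (Pu (S x - S y)) + nrm (Pu (N x - N y))"
    by (metis nrm_triangle_diff[OF nrm])
  also have "nrm (Pu (N x - N y)) \<le> \<gamma> * nrm (x - y)"
    by (rule order_trans[OF nrm_Pu_le N_lipschitz[OF assms]])
  finally show ?thesis using L_unstable[of "x - y"] by simp
qed

text \<open>
  \<open>b + \<gamma>\<close> is the contraction rate of the stable equation, and \<open>(1 + \<gamma>) / a\<close> that of the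
  unstable equation solved for the earlier state.
\<close>

definition \<kappa> :: real where
  "\<kappa> = max (b + \<gamma>) ((1 + \<gamma>) / a)"

lemma \<kappa>: "0 \<le> \<kappa>" "\<kappa> < 1"
  using a b \<gamma> by (auto simp: \<kappa>_def less_divide_eq le_max_iff_disj)

lemma stable_le_\<kappa>:
  assumes "nrm x \<le> r" "nrm y \<le> r" "nrm (x - y) \<le> d"
  shows "nrm (Ps (S x - S y)) \<le> \<kappa> * d"
proof -
  have "0 \<le> d" using assms(3) nonneg order_trans by blast
  have "nrm (Ps (S x - S y)) \<le> (b + \<gamma>) * nrm (x - y)"
    by (rule stable_contracts[OF assms(1,2)])
  also have "\<dots> \<le> \<kappa> * d"
    using assms(3) b \<gamma> \<kappa> nonneg by (intro mult_mono) (auto simp: \<kappa>_def)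
  finally show ?thesis .
qed

lemma le_\<kappa>_if_expands:
  assumes "a * t \<le> d + \<gamma> * d" "0 \<le> d"
  shows "t \<le> \<kappa> * d"
proof -
  have "t \<le> (1 + \<gamma>) / a * d"
    using assms(1) a \<gamma> by (simp add: field_simps)
  also have "\<dots> \<le> \<kappa> * d"
    using assms(2) by (intro mult_right_mono) (auto simp: \<kappa>_def)
  finally show ?thesis .
qed

subsection \<open>Orbits that stay in the ball\<close>

definition forward_orbit :: "(nat \<Rightarrow> 'a) \<Rightarrow> bool" where
  "forward_orbit x \<longleftrightarrow> (\<forall>n. nrm (x n) \<le> r \<and> x (Suc n) = S (x n))"

text \<open>Time runs backwards: \<open>y n\<close> is the state \<open>n\<close> steps before \<open>y 0\<close>.\<close>

definition backward_orbit :: "(nat \<Rightarrow> 'a) \<Rightarrow> bool" where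
  "backward_orbit y \<longleftrightarrow> (\<forall>n. nrm (y n) \<le> r \<and> y n = S (y (Suc n)))"

lemma backward_orbitD:
  assumes "backward_orbit y"
  shows "nrm (y n) \<le> r" and "S (y (Suc n)) = y n"
  using assms by (metis backward_orbit_def)+

lemma nrm_diff_le_2r: "nrm x \<le> r \<Longrightarrow> nrm y \<le> r \<Longrightarrow> nrm (x - y) \<le> 2 * r"
  using nrm_triangle_diff[OF nrm, of x y] by simp

text \<open>
  Let \<open>d\<close> bound the distance of the two orbits at all times. By the next state, the unstable
  components are at most \<open>\<kappa> d\<close> apart, and by the previous state so are the stable ones, except at
  time \<open>0\<close>. As \<open>\<kappa> < 1\<close>, the supremum of the distances is bounded by the exceptional term.
\<close>

lemma forward_orbit_diff:
  assumes x: "forward_orbit x" and y: "forward_orbit y"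
  shows "nrm (x n - y n) \<le> nrm (Ps (x 0 - y 0))"
proof (rule contraction_bound[where g = "\<lambda>n. nrm (x n - y n)" and k = \<kappa> and B = "2 * r"])
  have ball: "nrm (x n) \<le> r" "nrm (y n) \<le> r"
    and orbit: "x (Suc n) = S (x n)" "y (Suc n) = S (y n)" for n
    using x y by (simp_all add: forward_orbit_def)
  show "nrm (x n - y n) \<le> 2 * r" for n
    by (rule nrm_diff_le_2r[OF ball])
  fix d n assume d: "\<And>n. nrm (x n - y n) \<le> d"
  have d0: "0 \<le> d" using d[of 0] nonneg order_trans by blast
  have "a * nrm (Pu (x n - y n)) \<le> nrm (Pu (S (x n) - S (y n))) + \<gamma> * nrm (x n - y n)"
    by (rule unstable_expands[OF ball])
  also have "\<dots> \<le> d + \<gamma> * d"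
    using d[of n] \<gamma> order_trans[OF nrm_Pu_le d[of "Suc n"]]
    by (intro add_mono mult_left_mono) (auto simp: orbit)
  finally have "nrm (Pu (x n - y n)) \<le> \<kappa> * d"
    by (rule le_\<kappa>_if_expands[OF _ d0])
  moreover have "nrm (Ps (x n - y n)) \<le> max (nrm (Ps (x 0 - y 0))) (\<kappa> * d)"
  proof (cases n)
    case (Suc l)
    then show ?thesis
      using stable_le_\<kappa>[OF ball d[of l]] by (simp add: orbit le_max_iff_disj)
  qed simp
  ultimately show "nrm (x n - y n) \<le> max (nrm (Ps (x 0 - y 0))) (\<kappa> * d)"
    using nrm_max[of "x n - y n"] by auto
qed (use \<kappa> nonneg in auto)

text \<open>
  With time reversed, the exceptional term at time \<open>0\<close> is in the unstable component.
\<close>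

lemma backward_orbit_diff:
  assumes x: "backward_orbit x" and y: "backward_orbit y"
  shows "nrm (x n - y n) \<le> nrm (Pu (x 0 - y 0))"
proof (rule contraction_bound[where g = "\<lambda>n. nrm (x n - y n)" and k = \<kappa> and B = "2 * r"])
  have ball: "nrm (x n) \<le> r" "nrm (y n) \<le> r"
    and orbit: "S (x (Suc n)) = x n" "S (y (Suc n)) = y n" for n
    by (rule backward_orbitD[OF x] backward_orbitD[OF y])+
  show "nrm (x n - y n) \<le> 2 * r" for n
    by (rule nrm_diff_le_2r[OF ball])
  fix d n assume d: "\<And>n. nrm (x n - y n) \<le> d"
  have d0: "0 \<le> d" using d[of 0] nonneg order_trans by blast
  have "nrm (Ps (x n - y n)) \<le> \<kappa> * d"
    using stable_le_\<kappa>[OF ball d[of "Suc n"]] unfolding orbit .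
  moreover have "nrm (Pu (x n - y n)) \<le> max (nrm (Pu (x 0 - y 0))) (\<kappa> * d)"
  proof (cases n)
    case (Suc l)
    have "a * nrm (Pu (x n - y n)) \<le> nrm (Pu (S (x n) - S (y n))) + \<gamma> * nrm (x n - y n)"
      by (rule unstable_expands[OF ball])
    also have "\<dots> \<le> d + \<gamma> * d"
      using d[of n] \<gamma> order_trans[OF nrm_Pu_le d[of l]]
      by (intro add_mono mult_left_mono) (auto simp: Suc orbit)
    finally show ?thesis
      using le_\<kappa>_if_expands[OF _ d0] by (simp add: le_max_iff_disj)
  qed simp
  ultimately show "nrm (x n - y n) \<le> max (nrm (Pu (x 0 - y 0))) (\<kappa> * d)"
    using nrm_max[of "x n - y n"] by auto
qed (use \<kappa> nonneg in auto)

text \<open>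
  The unstable equation of \<open>x' = S x\<close> solved for the unstable component of \<open>x\<close>, that is,
  \<open>L\<^sub>u\<^sup>-\<^sup>1 (x'\<^sub>u - N\<^sub>u x)\<close>. In this direction the unstable equation contracts.
\<close>

definition pull_back :: "'a \<Rightarrow> 'a \<Rightarrow> 'a" where
  "pull_back x x' = Pu (SOME w. L (Pu w) = Pu (x' - N x))"

lemma L_pull_back: "L (pull_back x x') = Pu (x' - N x)"
  unfolding pull_back_def using L_surj by (rule someI_ex)

lemma Pu_pull_back: "Pu (pull_back x x') = pull_back x x'"
  by (simp add: pull_back_def Pu_Pu)

lemma Ps_pull_back: "Ps (pull_back x x') = 0"
  by (simp add: pull_back_def Ps_Pu)

lemma pull_back_diff:
  assumes "nrm x \<le> r" "nrm y \<le> r" "nrm (x - y) \<le> d" "nrm (x' - y') \<le> d"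
  shows "nrm (pull_back x x' - pull_back y y') \<le> \<kappa> * d"
proof (rule le_\<kappa>_if_expands)
  show "0 \<le> d" using assms(3) nonneg order_trans by blast
  let ?w = "pull_back x x' - pull_back y y'"
  have w: "Pu ?w = ?w" by (simp add: lin_simps Pu_pull_back)
  have "a * nrm ?w \<le> nrm (L ?w)"
    using L_unstable[of ?w] by (simp only: w)
  also have "L ?w = Pu ((x' - y') - (N x - N y))"
    by (simp add: lin_simps L_pull_back)
  also have "nrm \<dots> \<le> nrm (x' - y') + nrm (N x - N y)"
    by (rule order_trans[OF nrm_Pu_le nrm_triangle_diff[OF nrm]])
  also have "\<dots> \<le> d + \<gamma> * d"
    using assms \<gamma> by (intro add_mono order_trans[OF N_lipschitz] mult_left_mono) auto
  finally show "a * nrm ?w \<le> d + \<gamma> * d" .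
qed

lemma pull_back_0: "pull_back 0 0 = 0"
  using pull_back_diff[of 0 0 0 0 0] r L_unstable[of "pull_back 0 0"] L_pull_back[of 0 0] a
    nonneg[of "pull_back 0 0"] \<gamma>
  by (simp add: Pu_pull_back lin_simps N_0 mult_le_0_iff eq_0)

lemma pull_back_le:
  assumes "nrm x \<le> r" "nrm x' \<le> r"
  shows "nrm (pull_back x x') \<le> \<kappa> * r"
  using pull_back_diff[of x 0 r x' 0] assms r by (simp add: pull_back_0)

lemma stable_le:
  assumes "nrm x \<le> r"
  shows "nrm (Ps (S x)) \<le> \<kappa> * r"
  using stable_le_\<kappa>[of x 0 r] assms r by (simp add: lin_simps N_0)

lemma \<kappa>_r: "\<kappa> * r \<le> r"
  using \<kappa> r by (simp add: mult_left_le_one_le)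

lemma orbit_stepI:
  assumes "Ps x' = Ps (S x)" "Pu x = pull_back x x'"
  shows "x' = S x"
proof -
  have "Pu x' = Pu (S x)"
    using L_pull_back[of x x'] by (simp add: assms(2)[symmetric] lin_simps Pu_L)
  then show ?thesis using assms(1) by (metis Ps_plus_Pu)
qed

text \<open>
  The fixed points of \<open>\<Phi>\<close> in the proof are the forward orbits with initial stable component \<open>\<xi>\<close>:
  each entry takes its stable component from the previous entry and its unstable component, by
  \<open>pull_back\<close>, from the next.
\<close>

lemma ex_forward_orbit:
  assumes "nrm \<xi> \<le> r" and \<xi>: "Ps \<xi> = \<xi>"
  obtains x where "forward_orbit x" "Ps (x 0) = \<xi>"
proof -
  define st where "st x n = (case n of 0 \<Rightarrow> \<xi> | Suc l \<Rightarrow> Ps (S (x l)))" for x :: "nat \<Rightarrow> 'a" and n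
  define \<Phi> where "\<Phi> x n = st x n + pull_back (x n) (x (Suc n))" for x n
  have Ps_st: "Ps (st x n) = st x n" for x n
    by (simp add: st_def \<xi> Ps_Ps split: nat.split)
  have Pu_st: "Pu (st x n) = 0" for x n
    by (simp add: Pu_eq Ps_st)
  have Ps_\<Phi>: "Ps (\<Phi> x n) = st x n" and Pu_\<Phi>: "Pu (\<Phi> x n) = pull_back (x n) (x (Suc n))" for x n
    by (simp_all add: \<Phi>_def lin_simps Ps_st Pu_st Ps_pull_back Pu_pull_back)
  obtain x where ball: "\<And>n. nrm (x n) \<le> r" and fix_pt: "\<Phi> x = x"
  proof (rule family_contraction_fixed_point[OF nrm \<kappa> less_imp_le[OF r], of \<Phi>])
    fix x :: "nat \<Rightarrow> 'a" and n assume ball: "\<And>n. nrm (x n) \<le> r"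
    have "nrm (st x n) \<le> r"
      using assms(1) order_trans[OF stable_le[OF ball] \<kappa>_r] by (simp add: st_def split: nat.split)
    moreover have "nrm (pull_back (x n) (x (Suc n))) \<le> r"
      by (rule order_trans[OF pull_back_le[OF ball ball] \<kappa>_r])
    ultimately show "nrm (\<Phi> x n) \<le> r"
      using nrm_max[of "\<Phi> x n"] by (simp add: Ps_\<Phi> Pu_\<Phi>)
  next
    fix x y :: "nat \<Rightarrow> 'a" and d n
    assume ball: "\<And>n. nrm (x n) \<le> r" "\<And>n. nrm (y n) \<le> r" and d: "\<And>n. nrm (x n - y n) \<le> d"
    have "0 \<le> d" using d[of 0] nonneg order_trans by blast
    then have "nrm (st x n - st y n) \<le> \<kappa> * d"
      using stable_le_\<kappa>[OF ball d] \<kappa> by (auto simp: st_def lin_simps split: nat.split)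
    moreover have "nrm (pull_back (x n) (x (Suc n)) - pull_back (y n) (y (Suc n))) \<le> \<kappa> * d"
      by (rule pull_back_diff[OF ball d d])
    ultimately show "nrm (\<Phi> x n - \<Phi> y n) \<le> \<kappa> * d"
      using nrm_max[of "\<Phi> x n - \<Phi> y n"] by (simp add: lin_simps Ps_\<Phi> Pu_\<Phi>)
  qed blast
  have "x (Suc n) = S (x n)" for n
  proof (rule orbit_stepI)
    show "Ps (x (Suc n)) = Ps (S (x n))"
      using Ps_\<Phi>[of x "Suc n"] by (simp add: fix_pt st_def)
    show "Pu (x n) = pull_back (x n) (x (Suc n))"
      using Pu_\<Phi>[of x n] by (simp add: fix_pt)
  qed
  moreover have "Ps (x 0) = \<xi>"
    using Ps_\<Phi>[of x 0] by (simp add: fix_pt st_def)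
  ultimately show ?thesis
    using ball by (intro that) (auto simp: forward_orbit_def)
qed

lemma ex_backward_orbit:
  assumes "nrm \<xi> \<le> r" and \<xi>: "Pu \<xi> = \<xi>"
  obtains y where "backward_orbit y" "Pu (y 0) = \<xi>"
proof -
  define un where
    "un y n = (case n of 0 \<Rightarrow> \<xi> | Suc l \<Rightarrow> pull_back (y n) (y l))" for y :: "nat \<Rightarrow> 'a" and n
  define \<Phi> where "\<Phi> y n = Ps (S (y (Suc n))) + un y n" for y n
  have Pu_un: "Pu (un y n) = un y n" for y n
    by (simp add: un_def \<xi> Pu_pull_back split: nat.split)
  have Ps_un: "Ps (un y n) = 0" for y n
    by (metis Ps_Pu Pu_un)
  have Ps_\<Phi>: "Ps (\<Phi> y n) = Ps (S (y (Suc n)))" and Pu_\<Phi>: "Pu (\<Phi> y n) = un y n" for y n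
    unfolding \<Phi>_def linear_add[OF linear_Ps, of "Ps _"] linear_add[OF linear_Pu, of "Ps _"]
    by (simp_all add: Ps_un Pu_un Ps_Ps Pu_Ps)
  obtain y where ball: "\<And>n. nrm (y n) \<le> r" and fix_pt: "\<Phi> y = y"
  proof (rule family_contraction_fixed_point[OF nrm \<kappa> less_imp_le[OF r], of \<Phi>])
    fix y :: "nat \<Rightarrow> 'a" and n assume ball: "\<And>n. nrm (y n) \<le> r"
    have "nrm (un y n) \<le> r"
      using assms(1) order_trans[OF pull_back_le[OF ball ball] \<kappa>_r]
      by (simp add: un_def split: nat.split)
    moreover have "nrm (Ps (S (y (Suc n)))) \<le> r"
      by (rule order_trans[OF stable_le[OF ball] \<kappa>_r])
    ultimately show "nrm (\<Phi> y n) \<le> r"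
      using nrm_max[of "\<Phi> y n"] by (simp add: Ps_\<Phi> Pu_\<Phi>)
  next
    fix x y :: "nat \<Rightarrow> 'a" and d n
    assume ball: "\<And>n. nrm (x n) \<le> r" "\<And>n. nrm (y n) \<le> r" and d: "\<And>n. nrm (x n - y n) \<le> d"
    have "0 \<le> d" using d[of 0] nonneg order_trans by blast
    then have "nrm (un x n - un y n) \<le> \<kappa> * d"
      using pull_back_diff[OF ball d d] \<kappa> by (auto simp: un_def split: nat.split)
    moreover have "nrm (Ps (S (x (Suc n)) - S (y (Suc n)))) \<le> \<kappa> * d"
      by (rule stable_le_\<kappa>[OF ball d])
    ultimately show "nrm (\<Phi> x n - \<Phi> y n) \<le> \<kappa> * d"
      using nrm_max[of "\<Phi> x n - \<Phi> y n"]
      by (simp add: linear_diff[OF linear_Ps] linear_diff[OF linear_Pu] Ps_\<Phi> Pu_\<Phi>)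
  qed blast
  have step: "y n = S (y (Suc n))" for n
  proof (rule orbit_stepI)
    show "Ps (y n) = Ps (S (y (Suc n)))"
      using Ps_\<Phi>[of y n] by (simp add: fix_pt)
    show "Pu (y (Suc n)) = pull_back (y (Suc n)) (y n)"
      using Pu_\<Phi>[of y "Suc n"] by (simp add: fix_pt un_def)
  qed
  have "backward_orbit y"
    unfolding backward_orbit_def by (intro allI conjI ball step)
  moreover have "Pu (y 0) = \<xi>"
    using Pu_\<Phi>[of y 0] by (simp add: fix_pt un_def)
  ultimately show ?thesis by (rule that)
qed


subsection \<open>The stable and the unstable set\<close>

definition stable_set :: "'a set" where
  "stable_set = {x. \<forall>n. nrm ((S ^^ n) x) \<le> r}"

definition unstable_set :: "'a set" where
  "unstable_set = {y 0 |y. backward_orbit y}"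

lemma forward_orbit_iterates: "x \<in> stable_set \<Longrightarrow> forward_orbit (\<lambda>n. (S ^^ n) x)"
  by (simp add: stable_set_def forward_orbit_def)

lemma forward_orbit_start: "forward_orbit x \<Longrightarrow> x 0 \<in> stable_set"
proof -
  assume x: "forward_orbit x"
  have "(S ^^ n) (x 0) = x n" for n
    using x by (induction n) (auto simp: forward_orbit_def)
  then show ?thesis using x by (simp add: stable_set_def forward_orbit_def)
qed

lemma stable_set_ball: "x \<in> stable_set \<Longrightarrow> nrm x \<le> r"
  unfolding stable_set_def by (drule CollectD, drule spec[of _ 0]) simp

lemma unstable_set_ball: "x \<in> unstable_set \<Longrightarrow> nrm x \<le> r"
  by (auto simp: unstable_set_def backward_orbitD)

lemma backward_orbit_in_unstable_set:
  assumes "backward_orbit y"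
  shows "y n \<in> unstable_set"
proof -
  have "backward_orbit (\<lambda>l. y (n + l))"
    unfolding backward_orbit_def add_Suc_right
    by (intro allI conjI backward_orbitD(1)[OF assms] backward_orbitD(2)[OF assms, symmetric])
  then show ?thesis unfolding unstable_set_def by (intro CollectI exI[of _ "\<lambda>l. y (n + l)"]) simp
qed

lemma S_stable_set: "x \<in> stable_set \<Longrightarrow> S x \<in> stable_set"
proof -
  assume x: "x \<in> stable_set"
  have "nrm ((S ^^ Suc n) x) \<le> r" for n
    using x unfolding stable_set_def by blast
  then show ?thesis unfolding stable_set_def funpow_Suc_right o_apply by blast
qed

lemma unstable_set_S: "unstable_set \<subseteq> S ` unstable_set"
proof
  fix x assume "x \<in> unstable_set"
  then obtain y where y: "backward_orbit y" "x = y 0" by (auto simp: unstable_set_def)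
  have "y (Suc 0) \<in> unstable_set"
    by (rule backward_orbit_in_unstable_set[OF y(1)])
  moreover have "x = S (y (Suc 0))"
    by (simp only: backward_orbitD(2)[OF y(1)] y(2))
  ultimately show "x \<in> S ` unstable_set" by blast
qed

text \<open>
  The cone conditions: orbits that remain in the ball differ mainly in the component that the
  dynamics contracts in the respective direction of time.
\<close>

lemma stable_set_cone:
  assumes "x \<in> stable_set" "y \<in> stable_set"
  shows "nrm (x - y) \<le> nrm (Ps (x - y))"
  using forward_orbit_diff[OF forward_orbit_iterates[OF assms(1)] forward_orbit_iterates[OF assms(2)], of 0]
  by simp

lemma unstable_set_cone:
  assumes "x \<in> unstable_set" "y \<in> unstable_set"
  shows "nrm (x - y) \<le> nrm (Pu (x - y))"
  using assms backward_orbit_diff[of _ _ 0] by (auto simp: unstable_set_def)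

lemma stable_set_contracts:
  assumes "x \<in> stable_set" "y \<in> stable_set"
  shows "nrm (S x - S y) \<le> (b + \<gamma>) * nrm (x - y)"
  using stable_set_cone[OF S_stable_set[OF assms(1)] S_stable_set[OF assms(2)]]
    stable_contracts[OF stable_set_ball[OF assms(1)] stable_set_ball[OF assms(2)]] by linarith

lemma unstable_set_expands:
  assumes "x \<in> unstable_set" "y \<in> unstable_set"
  shows "(a - \<gamma>) * nrm (x - y) \<le> nrm (S x - S y)"
proof -
  have "a * nrm (x - y) \<le> a * nrm (Pu (x - y))"
    using unstable_set_cone[OF assms] a \<gamma> by (intro mult_left_mono) auto
  also have "\<dots> \<le> nrm (Pu (S x - S y)) + \<gamma> * nrm (x - y)"
    by (intro unstable_expands unstable_set_ball assms)
  also have "nrm (Pu (S x - S y)) \<le> nrm (S x - S y)"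
    by (rule nrm_Pu_le)
  finally show ?thesis by (simp add: algebra_simps)
qed

lemma zero_in_stable_set: "0 \<in> stable_set"
  using forward_orbit_start[of "\<lambda>_. 0"] r S_0 by (simp add: forward_orbit_def)

lemma zero_in_unstable_set: "0 \<in> unstable_set"
proof -
  have "backward_orbit (\<lambda>_. 0)" using r S_0 by (simp add: backward_orbit_def)
  from backward_orbit_in_unstable_set[OF this] show ?thesis .
qed

lemma stable_set_decay:
  assumes x: "x \<in> stable_set"
  shows "nrm ((S ^^ n) x) \<le> (b + \<gamma>) ^ n * r"
proof -
  have orbit: "(S ^^ n) x \<in> stable_set" for n
    by (induction n) (use x S_stable_set in auto)
  show ?thesis
  proof (induction n)
    case 0
    show ?case using stable_set_ball[OF x] by simp
  next
    case (Suc n)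
    have "nrm ((S ^^ Suc n) x) \<le> (b + \<gamma>) * nrm ((S ^^ n) x)"
      using stable_set_contracts[OF orbit[of n] zero_in_stable_set] S_0 by simp
    also have "\<dots> \<le> (b + \<gamma>) * ((b + \<gamma>) ^ n * r)"
      using Suc b \<gamma> by (intro mult_left_mono) auto
    finally show ?case by (simp add: mult.assoc)
  qed
qed

lemma backward_orbit_decay:
  assumes y: "backward_orbit y"
  shows "(a - \<gamma>) ^ n * nrm (y n) \<le> r"
proof (induction n)
  case 0
  show ?case using backward_orbitD(1)[OF y] by simp
next
  case (Suc n)
  have "(a - \<gamma>) * nrm (y (Suc n)) \<le> nrm (S (y (Suc n)))"
    using unstable_set_expands[OF backward_orbit_in_unstable_set[OF y] zero_in_unstable_set, of "Suc n"] S_0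
    by simp
  also have "S (y (Suc n)) = y n"
    by (rule backward_orbitD(2)[OF y])
  finally have "(a - \<gamma>) ^ n * ((a - \<gamma>) * nrm (y (Suc n))) \<le> (a - \<gamma>) ^ n * nrm (y n)"
    using a by (intro mult_left_mono) auto
  then show ?case using Suc by (simp add: mult_ac)
qed

text \<open>
  At a common point \<open>x\<close>, the map \<open>S\<close> both contracts and expands the distance from \<open>0\<close>.
\<close>

lemma stable_Int_unstable: "stable_set \<inter> unstable_set = {0}"
proof -
  have "x = 0" if x: "x \<in> stable_set" "x \<in> unstable_set" for x
  proof -
    have "(a - \<gamma>) * nrm x \<le> (b + \<gamma>) * nrm x"
      using unstable_set_expands[OF x(2) zero_in_unstable_set]
        stable_set_contracts[OF x(1) zero_in_stable_set] S_0 by simp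
    then have "(a - \<gamma> - (b + \<gamma>)) * nrm x \<le> 0" by (simp add: algebra_simps)
    moreover have "0 < a - \<gamma> - (b + \<gamma>)" using a b by simp
    ultimately show ?thesis using nonneg[of x] by (simp add: mult_le_0_iff eq_0)
  qed
  then show ?thesis using zero_in_stable_set zero_in_unstable_set by blast
qed

lemma Ps_stable_set: "Ps ` stable_set = {v \<in> range Ps. nrm v \<le> r}"
proof (intro equalityI subsetI)
  fix v assume "v \<in> Ps ` stable_set"
  then show "v \<in> {v \<in> range Ps. nrm v \<le> r}"
    using order_trans[OF nrm_Ps_le stable_set_ball] by auto
next
  fix v assume "v \<in> {v \<in> range Ps. nrm v \<le> r}"
  then have v: "nrm v \<le> r" "Ps v = v" by (auto simp: Ps_Ps)
  obtain x where "forward_orbit x" "Ps (x 0) = v" by (rule ex_forward_orbit[OF v])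
  then show "v \<in> Ps ` stable_set" using forward_orbit_start by blast
qed

lemma Pu_unstable_set: "Pu ` unstable_set = {v \<in> range Pu. nrm v \<le> r}"
proof (intro equalityI subsetI)
  fix v assume "v \<in> Pu ` unstable_set"
  then show "v \<in> {v \<in> range Pu. nrm v \<le> r}"
    using order_trans[OF nrm_Pu_le unstable_set_ball] by auto
next
  fix v assume "v \<in> {v \<in> range Pu. nrm v \<le> r}"
  then have v: "nrm v \<le> r" "Pu v = v" by (auto simp: Pu_Pu)
  obtain y where "backward_orbit y" "Pu (y 0) = v" by (rule ex_backward_orbit[OF v])
  then show "v \<in> Pu ` unstable_set" unfolding unstable_set_def by blast
qed

lemma stable_set_graph:
  "lipschitz_graph_over nrm p {v \<in> range Ps. nrm v \<le> r} (range Pu) ((+) p ` stable_set)"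
  unfolding Ps_stable_set[symmetric]
  by (rule lipschitz_graph_over_projection[OF nrm linear_Ps linear_Pu Ps_plus_Pu nrm_Pu_le])
     (rule stable_set_cone)

lemma unstable_set_graph:
  "lipschitz_graph_over nrm p {v \<in> range Pu. nrm v \<le> r} (range Ps) ((+) p ` unstable_set)"
  unfolding Pu_unstable_set[symmetric]
  by (rule lipschitz_graph_over_projection[OF nrm linear_Pu linear_Ps _ nrm_Ps_le])
     (use unstable_set_cone Ps_plus_Pu in \<open>auto simp: add.commute\<close>)

lemma direct_sum: "direct_sum_decomposition (range Pu) (range Ps)"
proof -
  have cont: "continuous_on UNIV Ps" "continuous_on UNIV Pu"
    by (rule lipschitz_wrt_imp_continuous_on[OF nrm, of 1];
        simp add: lipschitz_wrt_def linear_diff[OF linear_Ps, symmetric]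
          linear_diff[OF linear_Pu, symmetric] nrm_Ps_le nrm_Pu_le)+
  have kernel_Ps: "range Pu = {x. Ps x = 0}"
  proof (intro equalityI subsetI)
    fix x assume "x \<in> {x. Ps x = 0}"
    then have "x = Pu x" using Ps_plus_Pu[of x] by simp
    then show "x \<in> range Pu" by blast
  qed (auto simp: Ps_Pu)
  have kernel_Pu: "range Ps = {x. Pu x = 0}"
  proof (intro equalityI subsetI)
    fix x assume "x \<in> {x. Pu x = 0}"
    then have "x = Ps x" using Ps_plus_Pu[of x] by simp
    then show "x \<in> range Ps" by blast
  qed (auto simp: Pu_Ps)
  have "closed (range Pu)" "closed (range Ps)"
    unfolding kernel_Ps kernel_Pu using cont by (auto intro!: closed_Collect_eq)
  moreover have "range Pu \<inter> range Ps = {0}"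
  proof (intro equalityI subsetI)
    fix x assume "x \<in> range Pu \<inter> range Ps"
    then have "Ps x = 0" "Pu x = 0" using kernel_Ps kernel_Pu by auto
    then show "x \<in> {0}" using Ps_plus_Pu[of x] by simp
  qed (simp add: kernel_Ps kernel_Pu lin_simps)
  moreover have "\<exists>y\<in>range Pu. \<exists>z\<in>range Ps. x = y + z" for x
    using Ps_plus_Pu[of x] by (metis add.commute rangeI)
  ultimately show ?thesis
    by (simp add: direct_sum_decomposition_def linear_subspace_image linear_Ps linear_Pu)
qed


subsection \<open>The local manifolds of the equilibrium point\<close>

text \<open>
  Both sets consist of the points whose orbits stay in the ball. The prescribed growth conditions
  come for free, since the rates \<open>b + \<gamma>\<close> and \<open>a - \<gamma>\<close> beat \<open>1 - \<epsilon>\<close> and \<open>1 + \<epsilon>\<close>.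
\<close>

lemma local_manifolds:
  fixes T :: "'a \<Rightarrow> 'a"
  assumes T: "\<And>x. T (p + x) = p + S x" and cont: "continuous_on UNIV T"
    and \<epsilon>: "0 < \<epsilon>" "b + \<gamma> < 1 - \<epsilon>" "1 + \<epsilon> \<le> a - \<gamma>"
  defines "Ws \<equiv> (+) p ` stable_set" and "Wu \<equiv> (+) p ` unstable_set"
    and "U \<equiv> {x. nrm (x - p) \<le> r}"
  shows "Wu \<subseteq> T ` Wu"
    and "T ` Ws \<subseteq> Ws \<inter> range T"
    and "\<exists>g. homeomorphism Wu (T ` Wu) T g"
    and "Ws \<inter> Wu = {p}"
    and "\<exists>c<1. lipschitz_wrt nrm c Ws T"
    and "\<exists>c<1. lipschitz_wrt nrm c (T ` Wu) (inv_into Wu T)"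
    and "Ws = {x \<in> U. (\<forall>n. (T ^^ n) x \<in> U) \<and>
              (\<lambda>n. nrm ((T ^^ n) x - p)) \<in> o(\<lambda>n. (1 - \<epsilon>) ^ n)}"
    and "Wu = {x \<in> U. \<exists>y :: int \<Rightarrow> 'a.
              (\<forall>j\<le>0. y j \<in> U) \<and> y 0 = x \<and> (\<forall>j<0. y (j + 1) = T (y j)) \<and>
              bdd_above ((\<lambda>j. (1 + \<epsilon>) powi (- j) * nrm (y j - p)) ` {..0})}"
proof -
  have T_image: "T ` (+) p ` A = (+) p ` S ` A" for A
    by (simp add: image_image T)
  show "Wu \<subseteq> T ` Wu"
    unfolding Wu_def T_image by (rule image_mono[OF unstable_set_S])
  have "S ` stable_set \<subseteq> stable_set"
    using S_stable_set by blast
  then show "T ` Ws \<subseteq> Ws \<inter> range T"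
    unfolding Ws_def T_image[symmetric] by (auto simp: T)
  have expand: "(a - \<gamma>) * nrm (x - y) \<le> nrm (T x - T y)" if "x \<in> Wu" "y \<in> Wu" for x y
    using that unstable_set_expands by (auto simp: Wu_def T)
  have a\<gamma>: "0 < a - \<gamma>" "inverse (a - \<gamma>) < 1"
    using a \<gamma> by (auto intro: inverse_less_1_iff[THEN iffD2])
  note inv = expansion_inverse[OF nrm a\<gamma>(1) expand]
  show "\<exists>g. homeomorphism Wu (T ` Wu) T g"
    using inv(2) continuous_on_subset[OF cont] by blast
  show "\<exists>c<1. lipschitz_wrt nrm c (T ` Wu) (inv_into Wu T)"
    using inv(1) a\<gamma>(2) by blast
  have "Ws \<inter> Wu = (+) p ` (stable_set \<inter> unstable_set)"
    unfolding Ws_def Wu_def by (rule image_Int[symmetric]) simp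
  then show "Ws \<inter> Wu = {p}" by (simp add: stable_Int_unstable)
  have "lipschitz_wrt nrm (b + \<gamma>) Ws T"
    using stable_set_contracts b \<gamma> by (auto simp: lipschitz_wrt_def Ws_def T)
  then show "\<exists>c<1. lipschitz_wrt nrm c Ws T"
    using b by blast
  have iterates: "(T ^^ n) (p + x) = p + (S ^^ n) x" for n x
    by (induction n) (simp_all add: T)
  have small: "(\<lambda>n. nrm ((T ^^ n) (p + x) - p)) \<in> o(\<lambda>n. (1 - \<epsilon>) ^ n)" if "x \<in> stable_set" for x
  proof -
    have "(\<lambda>n. nrm ((T ^^ n) (p + x) - p)) \<in> O(\<lambda>n. (b + \<gamma>) ^ n)"
      using stable_set_decay[OF that] nonneg b \<gamma>
      by (intro bigoI[where c = r] always_eventually allI) (simp add: iterates mult.commute)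
    also have "(\<lambda>n. (b + \<gamma>) ^ n) \<in> o(\<lambda>n. (1 - \<epsilon>) ^ n)"
    proof (rule smalloI_tendsto)
      have "(\<lambda>n. ((b + \<gamma>) / (1 - \<epsilon>)) ^ n) \<longlonglongrightarrow> 0"
        using b \<gamma> \<epsilon> by (intro LIMSEQ_power_zero) (simp add: field_simps)
      then show "(\<lambda>n. (b + \<gamma>) ^ n / (1 - \<epsilon>) ^ n) \<longlonglongrightarrow> 0"
        by (simp add: power_divide)
      show "\<forall>\<^sub>F n in sequentially. (1 - \<epsilon>) ^ n \<noteq> 0"
        using b \<gamma> \<epsilon> by simp
    qed
    finally show ?thesis .
  qed
  show "Ws = {x \<in> U. (\<forall>n. (T ^^ n) x \<in> U) \<and>
              (\<lambda>n. nrm ((T ^^ n) x - p)) \<in> o(\<lambda>n. (1 - \<epsilon>) ^ n)}"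
  proof (intro equalityI subsetI)
    fix x assume "x \<in> Ws"
    then obtain e where e: "e \<in> stable_set" "x = p + e" by (auto simp: Ws_def)
    then show "x \<in> {x \<in> U. (\<forall>n. (T ^^ n) x \<in> U) \<and>
              (\<lambda>n. nrm ((T ^^ n) x - p)) \<in> o(\<lambda>n. (1 - \<epsilon>) ^ n)}"
      using small[OF e(1)] stable_set_ball[OF e(1)] by (simp add: U_def iterates stable_set_def)
  next
    fix x assume "x \<in> {x \<in> U. (\<forall>n. (T ^^ n) x \<in> U) \<and>
              (\<lambda>n. nrm ((T ^^ n) x - p)) \<in> o(\<lambda>n. (1 - \<epsilon>) ^ n)}"
    then have "nrm ((T ^^ n) (p + (x - p)) - p) \<le> r" for n
      by (simp add: U_def)
    then have "nrm ((S ^^ n) (x - p)) \<le> r" for n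
      unfolding iterates by simp
    then have "x - p \<in> stable_set" by (simp add: stable_set_def)
    then have "p + (x - p) \<in> Ws" unfolding Ws_def by (rule imageI)
    then show "x \<in> Ws" by simp
  qed
  show "Wu = {x \<in> U. \<exists>y :: int \<Rightarrow> 'a.
              (\<forall>j\<le>0. y j \<in> U) \<and> y 0 = x \<and> (\<forall>j<0. y (j + 1) = T (y j)) \<and>
              bdd_above ((\<lambda>j. (1 + \<epsilon>) powi (- j) * nrm (y j - p)) ` {..0})}"
    (is "_ = ?R")
  proof (intro equalityI subsetI)
    fix x assume "x \<in> Wu"
    then obtain z where z: "backward_orbit z" "x = p + z 0"
      by (auto simp: Wu_def unstable_set_def)
    define y where "y j = p + z (nat (- j))" for j :: int
    have "y j \<in> U" for j
      using backward_orbitD(1)[OF z(1)] by (simp add: y_def U_def)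
    moreover have "y 0 = x" by (simp add: y_def z(2))
    moreover have "y (j + 1) = T (y j)" if "j < 0" for j
    proof -
      have "nat (- j) = Suc (nat (- (j + 1)))" using that by simp
      then show ?thesis
        using backward_orbitD(2)[OF z(1), of "nat (- (j + 1))"] by (simp only: y_def T)
    qed
    moreover have "bdd_above ((\<lambda>j. (1 + \<epsilon>) powi (- j) * nrm (y j - p)) ` {..0})"
    proof (rule bdd_aboveI2)
      fix j :: int assume "j \<in> {..0}"
      then have "(1 + \<epsilon>) powi (- j) = (1 + \<epsilon>) ^ nat (- j)"
        by (simp add: power_int_def)
      also have "\<dots> \<le> (a - \<gamma>) ^ nat (- j)"
        using \<epsilon> by (intro power_mono) auto
      finally have "(1 + \<epsilon>) powi (- j) * nrm (z (nat (- j))) \<le> (a - \<gamma>) ^ nat (- j) * nrm (z (nat (- j)))"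
        by (intro mult_right_mono nonneg)
      then show "(1 + \<epsilon>) powi (- j) * nrm (y j - p) \<le> r"
        using backward_orbit_decay[OF z(1), of "nat (- j)"] by (simp add: y_def)
    qed
    ultimately show "x \<in> ?R"
      by (intro CollectI conjI exI[of _ y] allI impI) auto
  next
    fix x assume "x \<in> ?R"
    then obtain y :: "int \<Rightarrow> 'a"
      where y: "\<And>j. j \<le> 0 \<Longrightarrow> y j \<in> U" "y 0 = x" "\<And>j. j < 0 \<Longrightarrow> y (j + 1) = T (y j)"
      by blast
    define z where "z n = y (- int n) - p" for n
    have "nrm (z n) \<le> r" for n
      using y(1)[of "- int n"] by (simp add: z_def U_def)
    moreover have "z n = S (z (Suc n))" for n
      using y(3)[of "- int (Suc n)"] T[of "z (Suc n)"] by (simp add: z_def)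
    ultimately have "backward_orbit z"
      unfolding backward_orbit_def by (intro allI conjI)
    then have "z 0 \<in> unstable_set" by (rule backward_orbit_in_unstable_set)
    then have "p + z 0 \<in> Wu" unfolding Wu_def by (rule imageI)
    then show "x \<in> Wu" by (simp add: z_def y(2))
  qed
qed

end

section \<open>Splittings from the spectrum\<close>

text \<open>
  For real \<open>c\<close>, the operator \<open>c - L\<close> acts on the two factors of the complexification separately, so
  its bijectivity there descends to \<open>V\<close>. Surjectivity is what makes \<open>V\<close> invariant under \<open>L\<close>.
\<close>

lemma real_point_outside_spectrum_on:
  assumes V: "subspace V" and c: "of_real c \<notin> spectrum_on V L"
  shows "(\<lambda>x. c *\<^sub>R x - L x) ` V = V"
    and "\<exists>K. \<forall>x\<in>V. norm x \<le> K * norm (c *\<^sub>R x - L x)"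
proof -
  have 0: "0 \<in> V" using V by (rule subspace_0)
  let ?A = "blinfun_apply (cscale (of_real c) - complexification L)"
  have A: "?A (x, y) = (c *\<^sub>R x - L x, c *\<^sub>R y - L y)" for x y
    by (simp add: minus_blinfun.rep_eq cscale_apply complexification_apply)
  have inj: "inj_on ?A (V \<times> V)" and surj: "?A ` (V \<times> V) = V \<times> V"
    and "\<exists>K. \<forall>w\<in>V \<times> V. norm (inv_into (V \<times> V) ?A w) \<le> K * norm w"
    using c by (auto simp: spectrum_on_def bounded_bijection_on_def bij_betw_def)
  then obtain K where K: "\<And>w. w \<in> V \<times> V \<Longrightarrow> norm (inv_into (V \<times> V) ?A w) \<le> K * norm w"
    by blast
  have "fst ` ?A ` (V \<times> V) = V" unfolding surj using 0 by auto
  moreover have "fst ` ?A ` (V \<times> V) = (\<lambda>x. c *\<^sub>R x - L x) ` V"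
    using 0 by (force simp: A image_iff)
  ultimately show "(\<lambda>x. c *\<^sub>R x - L x) ` V = V" by simp
  have "norm x \<le> K * norm (c *\<^sub>R x - L x)" if "x \<in> V" for x
  proof -
    have x: "(x, 0) \<in> V \<times> V" using that 0 by simp
    have "norm (inv_into (V \<times> V) ?A (?A (x, 0))) \<le> K * norm (?A (x, 0))"
      using surj x by (intro K) blast
    then show ?thesis
      unfolding inv_into_f_f[OF inj x] by (simp add: A norm_Pair)
  qed
  then show "\<exists>K. \<forall>x\<in>V. norm x \<le> K * norm (c *\<^sub>R x - L x)" by blast
qed

lemma linear_proj_s: "linear (proj_s L)"
proof (rule linearI)
  show "proj_s L (x + y) = proj_s L x + proj_s L y" for x y
    using blinfun.add_right[of "riesz_integral L" "(x, 0)" "(y, 0)"] by (simp add: proj_s_def)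
  show "proj_s L (c *\<^sub>R x) = c *\<^sub>R proj_s L x" for c x
    using blinfun.scaleR_right[of "riesz_integral L" c "(x, 0)"] by (simp add: proj_s_def)
qed

lemma linear_proj_u: "linear (proj_u L)"
  using linear_compose_sub[OF linear_ident linear_proj_s[of L]]
  by (simp add: proj_u_def[abs_def])

text \<open>
  A vector \<open>x\<close> in both subspaces satisfies \<open>0 = nrm (x - x) = nrm x\<close>, so the sum is direct. By
  uniqueness of components, \<open>x = \<pi>\<^sub>u x + \<pi>\<^sub>s x\<close> is the decomposition of \<open>x\<close>. The points \<open>1\<close> and \<open>0\<close>, outside the spectra of \<open>L\<^sub>s\<close> and \<open>L\<^sub>u\<close> respectively,
  then give invariance of both subspaces and invertibility of \<open>L\<^sub>u\<close>; the operator norms give the rates.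
\<close>

lemma adapted_norm_splitting:
  assumes "adapted_norm nrm L a b"
  shows "proj_s L (proj_s L x) = proj_s L x"
    and "nrm x = max (nrm (proj_s L x)) (nrm (proj_u L x))"
    and "proj_s L (L x) = L (proj_s L x)"
    and "nrm (L (proj_s L x)) \<le> b * nrm (proj_s L x)"
    and "a * nrm (proj_u L x) \<le> nrm (L (proj_u L x))"
    and "\<exists>y. L (proj_u L y) = proj_u L x"
proof -
  note P = linear_proj_s[of L] and Q = linear_proj_u[of L]
  have nrm: "equivalent_norm nrm" and ab: "0 < b" "b < 1" "1 < a"
    and spec: "spectrum_on (space_s L) L \<subseteq> {\<mu>. cmod \<mu> < b}"
      "spectrum_on (space_u L) L \<subseteq> {\<mu>. cmod \<mu> > a}"
    and op_s: "op_norm_on nrm (space_s L) L \<le> b"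
    and op_u: "op_norm_on nrm (space_u L) (inv_into (space_u L) L) \<le> inverse a"
    and max: "\<And>xu xs. xu \<in> space_u L \<Longrightarrow> xs \<in> space_s L \<Longrightarrow> nrm (xu + xs) = max (nrm xu) (nrm xs)"
    using assms by (auto simp: adapted_norm_def)
  note nonneg = nrm_nonneg[OF nrm] and eq_0 = nrm_eq_0[OF nrm]
  have in_s: "proj_s L x \<in> space_s L" and in_u: "proj_u L x \<in> space_u L" for x
    by (simp_all add: space_s_def space_u_def)
  have sub_s: "subspace (space_s L)" and sub_u: "subspace (space_u L)"
    by (simp_all add: space_s_def space_u_def linear_subspace_image P Q)
  have split: "proj_u L x + proj_s L x = x" for x
    by (simp add: proj_u_def)
  show "nrm x = max (nrm (proj_s L x)) (nrm (proj_u L x))"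
    using max[OF in_u in_s, of x x] by (simp add: split max.commute)
  have trivial: "x = 0" if "x \<in> space_u L" "x \<in> space_s L" for x
    using max[OF that(1) subspace_neg[OF sub_s that(2)]] nonneg[of x] eq_0[of x] eq_0[of 0]
    by (auto simp: nrm_minus[OF nrm])
  have proj_s_u: "proj_s L x = 0" if "x \<in> space_u L" for x
  proof (rule trivial[OF _ in_s])
    have "proj_s L x = x - proj_u L x" by (simp add: proj_u_def)
    then show "proj_s L x \<in> space_u L" using subspace_diff[OF sub_u that in_u] by simp
  qed
  have proj_s_s: "proj_s L x = x" if "x \<in> space_s L" for x
  proof -
    have "proj_u L x = 0"
      by (rule trivial[OF in_u]) (simp add: proj_u_def subspace_diff[OF sub_s that in_s])
    then show ?thesis by (simp add: proj_u_def)
  qed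
  show "proj_s L (proj_s L x) = proj_s L x"
    by (rule proj_s_s[OF in_s])
  \<comment> \<open>If \<open>I - L\<close> maps the stable space to itself, then so does \<open>L\<close>.\<close>
  have "of_real 1 \<notin> spectrum_on (space_s L) L"
    using spec(1) ab by auto
  from real_point_outside_spectrum_on(1)[OF sub_s this]
  have inv_s: "L x \<in> space_s L" if "x \<in> space_s L" for x
  proof -
    have "1 *\<^sub>R x - L x \<in> space_s L"
      using that \<open>_ = space_s L\<close> by blast
    from subspace_diff[OF sub_s that this] show ?thesis by simp
  qed
  have 0: "of_real 0 \<notin> spectrum_on (space_u L) L"
    using spec(2) ab by auto
  have img: "(\<lambda>x. - L x) ` space_u L = space_u L"
    using real_point_outside_spectrum_on(1)[OF sub_u 0] by simp
  obtain K where K: "\<And>x. x \<in> space_u L \<Longrightarrow> norm x \<le> K * norm (L x)"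
    using real_point_outside_spectrum_on(2)[OF sub_u 0] by auto
  have inv_u: "L x \<in> space_u L" if "x \<in> space_u L" for x
    using subspace_neg[OF sub_u, of "- L x"] img that by auto
  have surj_u: "\<exists>y\<in>space_u L. L y = x" if x: "x \<in> space_u L" for x
  proof -
    obtain y where "y \<in> space_u L" "- x = - L y"
      using subspace_neg[OF sub_u x] img by blast
    then show ?thesis by auto
  qed
  have inj_u: "inj_on L (space_u L)"
  proof (rule inj_onI)
    fix x y assume xy: "x \<in> space_u L" "y \<in> space_u L" "L x = L y"
    have "norm (x - y) \<le> 0"
      using K[OF subspace_diff[OF sub_u xy(1,2)]] xy(3) by (simp add: blinfun.diff_right)
    then show "x = y" by simp
  qed
  have inv_bound: "norm (inv_into (space_u L) L y) \<le> K * norm y" if "y \<in> space_u L" for y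
    using surj_u[OF that] K inj_u by auto
  show "proj_s L (L x) = L (proj_s L x)"
  proof -
    have "proj_s L (L x) = proj_s L (L (proj_u L x) + L (proj_s L x))"
      unfolding blinfun.add_right[symmetric] split ..
    also have "\<dots> = L (proj_s L x)"
      by (simp add: linear_add[OF P] proj_s_u[OF inv_u[OF in_u]] proj_s_s[OF inv_s[OF in_s]])
    finally show ?thesis .
  qed
  show "nrm (L (proj_s L x)) \<le> b * nrm (proj_s L x)"
    using op_norm_on_bound[OF nrm in_s[of x] norm_blinfun[of L]] mult_right_mono[OF op_s nonneg]
    by (rule order_trans)
  show "a * nrm (proj_u L x) \<le> nrm (L (proj_u L x))"
  proof -
    have "nrm (inv_into (space_u L) L (L (proj_u L x))) \<le> inverse a * nrm (L (proj_u L x))"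
      using op_norm_on_bound[OF nrm inv_u[OF in_u[of x]] inv_bound] mult_right_mono[OF op_u nonneg]
      by (rule order_trans)
    then show ?thesis
      using ab by (simp add: inv_into_f_f[OF inj_u in_u] field_simps)
  qed
  show "\<exists>y. L (proj_u L y) = proj_u L x"
  proof -
    obtain y where y: "y \<in> space_u L" "L y = proj_u L x" using surj_u[OF in_u] by blast
    have "proj_u L y = y" by (simp add: proj_u_def proj_s_u[OF y(1)])
    then show ?thesis using y(2) by metis
  qed
qed

theorem theorem3p3:
  fixes T :: "'a::banach \<Rightarrow> 'a"
    and nrm :: "'a \<Rightarrow> real"
    and p :: 'a
  assumes "continuous_on UNIV T"
    and "weakly_hyperbolic_point nrm T p"
  shows "\<exists>(Xu :: 'a set) (Xs :: 'a set) (\<epsilon>\<^sub>0 :: real) (U :: 'a set) (Vu :: 'a set) (Vs :: 'a set)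
           (Wu :: 'a set) (Ws :: 'a set).
      direct_sum_decomposition Xu Xs \<and>
      0 < \<epsilon>\<^sub>0 \<and> \<epsilon>\<^sub>0 < 1 \<and>
      neighbourhood_in UNIV p U \<and>
      neighbourhood_in Xu 0 Vu \<and>
      neighbourhood_in Xs 0 Vs \<and>
      \<comment> \<open>(a)\<close>
      lipschitz_graph_over nrm p Vu Xs Wu \<and>
      lipschitz_graph_over nrm p Vs Xu Ws \<and>
      \<comment> \<open>(b)\<close>
      Wu \<subseteq> T ` Wu \<and>
      T ` Ws \<subseteq> Ws \<inter> range T \<and>
      (\<exists>g. homeomorphism Wu (T ` Wu) T g) \<and>
      \<comment> \<open>(c)\<close>
      Ws \<inter> Wu = {p} \<and>
      \<comment> \<open>(d)\<close>
      (\<exists>c<1. lipschitz_wrt nrm c Ws T) \<and>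
      (\<exists>c<1. lipschitz_wrt nrm c (T ` Wu) (inv_into Wu T)) \<and>
      \<comment> \<open>(e)\<close>
      Ws = {x \<in> U. (\<forall>n. (T ^^ n) x \<in> U) \<and>
              (\<lambda>n. nrm ((T ^^ n) x - p)) \<in> o(\<lambda>n. (1 - \<epsilon>\<^sub>0) ^ n)} \<and>
      Wu = {x \<in> U. \<exists>y :: int \<Rightarrow> 'a.
              (\<forall>j\<le>0. y j \<in> U) \<and> y 0 = x \<and> (\<forall>j<0. y (j + 1) = T (y j)) \<and>
              bdd_above ((\<lambda>j. (1 + \<epsilon>\<^sub>0) powi (- j) * nrm (y j - p)) ` {..0})}"
proof -
  obtain L N a b \<gamma> U0 where p: "T p = p"
    and T: "\<And>x. T (x + p) - p = blinfun_apply L x + N x"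
    and adapted: "adapted_norm nrm L a b" and U0: "neighbourhood_in UNIV 0 U0"
    and gap: "0 < \<gamma>" "b + 2 * \<gamma> < 1" "1 < a - 2 * \<gamma>" and N: "lipschitz_wrt nrm \<gamma> U0 N"
    using assms(2) unfolding weakly_hyperbolic_point_def by blast
  have nrm: "equivalent_norm nrm" and b: "0 < b"
    using adapted by (simp_all add: adapted_norm_def)
  obtain r where r: "0 < r" "\<And>x. nrm x \<le> r \<Longrightarrow> x \<in> U0"
    using neighbourhood_in_UNIV_contains_ball[OF nrm U0] by blast
  have N_0: "N 0 = 0"
    using T[of 0] p by simp
  interpret perturbed_splitting nrm "proj_s L" "proj_u L" "blinfun_apply L" N a b \<gamma> r
  proof (rule perturbed_splitting.intro)
    show "linear (blinfun_apply L)"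
      by (rule bounded_linear.linear[OF blinfun.bounded_linear_right])
    show "nrm (N x - N y) \<le> \<gamma> * nrm (x - y)" if "nrm x \<le> r" "nrm y \<le> r" for x y
      using N r(2)[OF that(1)] r(2)[OF that(2)] unfolding lipschitz_wrt_def by blast
    show "b + \<gamma> < 1" "1 + \<gamma> < a" using gap by auto
  qed (fact nrm linear_proj_s proj_u_def N_0 r(1) gap(1) b adapted_norm_splitting[OF adapted])+
  let ?U = "{x. nrm (x - p) \<le> r}"
  let ?Vu = "{v \<in> range (proj_u L). nrm v \<le> r}" and ?Vs = "{v \<in> range (proj_s L). nrm v \<le> r}"
  have T_eq: "T (p + x) = p + (L x + N x)" for x
    using T[of x] by (simp add: algebra_simps)
  have \<epsilon>: "\<gamma> < 1" "b + \<gamma> < 1 - \<gamma>" "1 + \<gamma> \<le> a - \<gamma>" using gap b by auto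
  have U: "neighbourhood_in UNIV p ?U"
    using neighbourhood_in_nrm_ball[OF nrm UNIV_I r(1)] by simp
  have V: "neighbourhood_in (range (proj_u L)) 0 ?Vu" "neighbourhood_in (range (proj_s L)) 0 ?Vs"
    using neighbourhood_in_nrm_ball[OF nrm _ r(1), of 0]
      subspace_0[OF linear_subspace_image[OF linear_Pu subspace_UNIV]]
      subspace_0[OF linear_subspace_image[OF linear_Ps subspace_UNIV]] by simp_all
  note facts = direct_sum gap(1) \<epsilon>(1) U V unstable_set_graph stable_set_graph
    local_manifolds[OF T_eq assms(1) gap(1) \<epsilon>(2,3)]
  show ?thesis
    by (rule exI[of _ "range (proj_u L)"], rule exI[of _ "range (proj_s L)"], rule exI[of _ \<gamma>],
        rule exI[of _ ?U], rule exI[of _ ?Vu], rule exI[of _ ?Vs],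
        rule exI[of _ "(+) p ` unstable_set"], rule exI[of _ "(+) p ` stable_set"], intro conjI)
       (fact facts)+
qed

end
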